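(* Let $\mathcal{C}$ be an abelian category and let $A\xrightarrow{f} B\xrightarrow{g} C$ be morphisms in $\mathcal{C}$. Then there is an exact sequence $$0\to \ker f\to \ker (gf)\to \ker g\xrightarrow{\ \delta\ } \operatorname{cok} f\to \operatorname{cok} (gf) \to \operatorname{cok} g\to 0,$$ where $\delta$ is the composition of the canonical morphisms $\ker g\to B\to \operatorname{cok} f$.
   Context: $\operatorname{cok}$ denotes cokernel. The unnamed morphisms are the natural ones: $\ker f\to\ker(gf)$ is the inclusion of subobjects of $A$; $\ker(gf)\to\ker g$ is induced by $f$; $\operatorname{cok} f\to\operatorname{cok}(gf)$ is induced by $g$; $\operatorname{cok}(gf)\to\operatorname{cok} g$ is the canonical projection of quotients of $C$. *)

theory Defs
  imports "HOL-Algebra.Group"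
begin

record ('o, 'm) category_data =
  Obj :: "'o set"
  Arr :: "'m set"
  Dom :: "'m \<Rightarrow> 'o"
  Cod :: "'m \<Rightarrow> 'o"
  Ident :: "'o \<Rightarrow> 'm"
  Comp :: "'m \<Rightarrow> 'm \<Rightarrow> 'm"  (infixl "\<cdot>\<index>" 70)

text \<open>Composition is written right to left: \<open>g \<cdot> f\<close> is \<open>g\<close> after \<open>f\<close>.\<close>

definition Hom :: "('o, 'm, 'e) category_data_scheme \<Rightarrow> 'o \<Rightarrow> 'o \<Rightarrow> 'm set" where
  "Hom C a b = {f \<in> Arr C. Dom C f = a \<and> Cod C f = b}"

locale category =
  fixes C :: "('o, 'm, 'e) category_data_scheme" (structure)
  assumes dom_in_Obj: "f \<in> Arr C \<Longrightarrow> Dom C f \<in> Obj C"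
    and cod_in_Obj: "f \<in> Arr C \<Longrightarrow> Cod C f \<in> Obj C"
    and ident_in_Hom: "a \<in> Obj C \<Longrightarrow> Ident C a \<in> Hom C a a"
    and comp_in_Hom: "\<lbrakk>f \<in> Hom C a b; g \<in> Hom C b c\<rbrakk> \<Longrightarrow> g \<cdot> f \<in> Hom C a c"
    and comp_assoc:
      "\<lbrakk>f \<in> Hom C a b; g \<in> Hom C b c; h \<in> Hom C c d\<rbrakk> \<Longrightarrow> (h \<cdot> g) \<cdot> f = h \<cdot> (g \<cdot> f)"
    and comp_ident_right: "f \<in> Hom C a b \<Longrightarrow> f \<cdot> Ident C a = f"
    and comp_ident_left: "f \<in> Hom C a b \<Longrightarrow> Ident C b \<cdot> f = f"

definition is_mono :: "('o, 'm, 'e) category_data_scheme \<Rightarrow> 'm \<Rightarrow> bool" where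
  "is_mono C f \<longleftrightarrow> f \<in> Arr C \<and>
     (\<forall>x. \<forall>g \<in> Hom C x (Dom C f). \<forall>h \<in> Hom C x (Dom C f).
        f \<cdot>\<^bsub>C\<^esub> g = f \<cdot>\<^bsub>C\<^esub> h \<longrightarrow> g = h)"

definition is_epi :: "('o, 'm, 'e) category_data_scheme \<Rightarrow> 'm \<Rightarrow> bool" where
  "is_epi C f \<longleftrightarrow> f \<in> Arr C \<and>
     (\<forall>x. \<forall>g \<in> Hom C (Cod C f) x. \<forall>h \<in> Hom C (Cod C f) x.
        g \<cdot>\<^bsub>C\<^esub> f = h \<cdot>\<^bsub>C\<^esub> f \<longrightarrow> g = h)"

definition is_zero_object :: "('o, 'm, 'e) category_data_scheme \<Rightarrow> 'o \<Rightarrow> bool" where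
  "is_zero_object C z \<longleftrightarrow> z \<in> Obj C \<and>
     (\<forall>a \<in> Obj C. (\<exists>!f. f \<in> Hom C a z) \<and> (\<exists>!f. f \<in> Hom C z a))"

record ('o, 'm) preadditive_data = "('o, 'm) category_data" +
  Add :: "'m \<Rightarrow> 'm \<Rightarrow> 'm"  (infixl "\<oplus>\<index>" 65)
  Zero :: "'o \<Rightarrow> 'o \<Rightarrow> 'm"

definition hom_group :: "('o, 'm, 'e) preadditive_data_scheme \<Rightarrow> 'o \<Rightarrow> 'o \<Rightarrow> 'm monoid" where
  "hom_group C a b = \<lparr>carrier = Hom C a b, mult = Add C, one = Zero C a b\<rparr>"

locale preadditive_category = category C
  for C :: "('o, 'm, 'e) preadditive_data_scheme" (structure) +
  assumes hom_comm_group: "\<lbrakk>a \<in> Obj C; b \<in> Obj C\<rbrakk> \<Longrightarrow> comm_group (hom_group C a b)"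
    and comp_add_right:
      "\<lbrakk>f \<in> Hom C a b; f' \<in> Hom C a b; g \<in> Hom C b c\<rbrakk>
        \<Longrightarrow> g \<cdot> (f \<oplus> f') = (g \<cdot> f) \<oplus> (g \<cdot> f')"
    and comp_add_left:
      "\<lbrakk>f \<in> Hom C a b; g \<in> Hom C b c; g' \<in> Hom C b c\<rbrakk>
        \<Longrightarrow> (g \<oplus> g') \<cdot> f = (g \<cdot> f) \<oplus> (g' \<cdot> f)"

definition is_biproduct ::
  "('o, 'm, 'e) preadditive_data_scheme \<Rightarrow> 'o \<Rightarrow> 'o \<Rightarrow> 'o \<Rightarrow> 'm \<Rightarrow> 'm \<Rightarrow> 'm \<Rightarrow> 'm \<Rightarrow> bool" where
  "is_biproduct C a b s i j p q \<longleftrightarrow>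
     i \<in> Hom C a s \<and> j \<in> Hom C b s \<and> p \<in> Hom C s a \<and> q \<in> Hom C s b \<and>
     p \<cdot>\<^bsub>C\<^esub> i = Ident C a \<and> q \<cdot>\<^bsub>C\<^esub> j = Ident C b \<and>
     q \<cdot>\<^bsub>C\<^esub> i = Zero C a b \<and> p \<cdot>\<^bsub>C\<^esub> j = Zero C b a \<and>
     (i \<cdot>\<^bsub>C\<^esub> p) \<oplus>\<^bsub>C\<^esub> (j \<cdot>\<^bsub>C\<^esub> q) = Ident C s"

text \<open>A kernel or cokernel is a morphism, determined only up to unique isomorphism; its object
  part is the domain of the kernel, respectively the codomain of the cokernel.\<close>

definition is_kernel :: "('o, 'm, 'e) preadditive_data_scheme \<Rightarrow> 'm \<Rightarrow> 'm \<Rightarrow> bool" where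
  "is_kernel C f k \<longleftrightarrow> f \<in> Arr C \<and> k \<in> Arr C \<and> Cod C k = Dom C f \<and>
     f \<cdot>\<^bsub>C\<^esub> k = Zero C (Dom C k) (Cod C f) \<and>
     (\<forall>x. \<forall>h \<in> Hom C x (Dom C f). f \<cdot>\<^bsub>C\<^esub> h = Zero C x (Cod C f) \<longrightarrow>
        (\<exists>!u. u \<in> Hom C x (Dom C k) \<and> k \<cdot>\<^bsub>C\<^esub> u = h))"

definition is_cokernel :: "('o, 'm, 'e) preadditive_data_scheme \<Rightarrow> 'm \<Rightarrow> 'm \<Rightarrow> bool" where
  "is_cokernel C f q \<longleftrightarrow> f \<in> Arr C \<and> q \<in> Arr C \<and> Dom C q = Cod C f \<and>
     q \<cdot>\<^bsub>C\<^esub> f = Zero C (Dom C f) (Cod C q) \<and>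
     (\<forall>x. \<forall>h \<in> Hom C (Cod C f) x. h \<cdot>\<^bsub>C\<^esub> f = Zero C (Dom C f) x \<longrightarrow>
        (\<exists>!u. u \<in> Hom C (Cod C q) x \<and> u \<cdot>\<^bsub>C\<^esub> q = h))"

text \<open>The axioms of Mac Lane, \<^emph>\<open>Categories for the Working Mathematician\<close>, Section VIII.3.\<close>

locale abelian_category = preadditive_category C
  for C :: "('o, 'm, 'e) preadditive_data_scheme" (structure) +
  assumes zero_object_exists: "\<exists>z. is_zero_object C z"
    and biproduct_exists:
      "\<lbrakk>a \<in> Obj C; b \<in> Obj C\<rbrakk> \<Longrightarrow> \<exists>s i j p q. is_biproduct C a b s i j p q"
    and kernel_exists: "f \<in> Arr C \<Longrightarrow> \<exists>k. is_kernel C f k"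
    and cokernel_exists: "f \<in> Arr C \<Longrightarrow> \<exists>q. is_cokernel C f q"
    and mono_is_kernel: "is_mono C m \<Longrightarrow> \<exists>f. is_kernel C f m"
    and epi_is_cokernel: "is_epi C e \<Longrightarrow> \<exists>f. is_cokernel C f e"

definition is_image :: "('o, 'm, 'e) preadditive_data_scheme \<Rightarrow> 'm \<Rightarrow> 'm \<Rightarrow> bool" where
  "is_image C f i \<longleftrightarrow> (\<exists>q. is_cokernel C f q \<and> is_kernel C q i)"

text \<open>Exactness at the middle object says that the image of \<open>f\<close> and the kernel of \<open>g\<close> are the
  same subobject, that is, that one monomorphism represents both.\<close>

definition exact_at :: "('o, 'm, 'e) preadditive_data_scheme \<Rightarrow> 'm \<Rightarrow> 'm \<Rightarrow> bool" where
  "exact_at C f g \<longleftrightarrow> Cod C f = Dom C g \<and> (\<exists>i. is_image C f i \<and> is_kernel C g i)"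

definition exact_sequence :: "('o, 'm, 'e) preadditive_data_scheme \<Rightarrow> 'm list \<Rightarrow> bool" where
  "exact_sequence C fs \<longleftrightarrow> set fs \<subseteq> Arr C \<and> successively (exact_at C) fs"

end

theory Submission
  imports Defs
begin

text \<open>
  Exactness can be tested on generalized elements up to epimorphic cover: if \<open>g \<cdot> f = 0\<close> and every \<open>h\<close>
  with \<open>g \<cdot> h = 0\<close> satisfies \<open>h \<cdot> e = f \<cdot> t\<close> for some epimorphism \<open>e\<close> and some \<open>t\<close>, then the sequence
  \<open>f, g\<close> is exact in the middle.  Since epimorphisms of an abelian category are stable under
  pullback, elements lift along cokernels, and elements killed by \<open>cok f\<close> lift along \<open>f\<close>, after
  passing to a cover.  Each of the six exactness claims is then the usual diagram chase for modules.
\<close>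

section \<open>Typed forms of the universal properties and of cancellation\<close>

lemma HomD:
  assumes "f \<in> Hom C a b"
  shows "f \<in> Arr C" "Dom C f = a" "Cod C f = b"
  using assms by (auto simp: Hom_def)

lemma kernel_in_Hom: "is_kernel C f k \<Longrightarrow> f \<in> Hom C a b \<Longrightarrow> k \<in> Hom C (Dom C k) a"
  by (auto simp: is_kernel_def Hom_def)

lemma kernel_comp: "is_kernel C f k \<Longrightarrow> f \<in> Hom C a b \<Longrightarrow> f \<cdot>\<^bsub>C\<^esub> k = Zero C (Dom C k) b"
  by (auto simp: is_kernel_def Hom_def)

lemma kernel_lift:
  assumes "is_kernel C f k" "f \<in> Hom C a b" "h \<in> Hom C x a" "f \<cdot>\<^bsub>C\<^esub> h = Zero C x b"
  obtains u where "u \<in> Hom C x (Dom C k)" "k \<cdot>\<^bsub>C\<^esub> u = h"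
  using assms(1,3,4) HomD(2,3)[OF assms(2)] unfolding is_kernel_def by metis

lemma cokernel_in_Hom: "is_cokernel C f q \<Longrightarrow> f \<in> Hom C a b \<Longrightarrow> q \<in> Hom C b (Cod C q)"
  by (auto simp: is_cokernel_def Hom_def)

lemma cokernel_comp: "is_cokernel C f q \<Longrightarrow> f \<in> Hom C a b \<Longrightarrow> q \<cdot>\<^bsub>C\<^esub> f = Zero C a (Cod C q)"
  by (auto simp: is_cokernel_def Hom_def)

lemma cokernel_lift:
  assumes "is_cokernel C f q" "f \<in> Hom C a b" "h \<in> Hom C b x" "h \<cdot>\<^bsub>C\<^esub> f = Zero C a x"
  obtains u where "u \<in> Hom C (Cod C q) x" "u \<cdot>\<^bsub>C\<^esub> q = h"
  using assms(1,3,4) HomD(2,3)[OF assms(2)] unfolding is_cokernel_def by metis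

lemma mono_cancel:
  assumes "is_mono C m" "m \<in> Hom C a b" "u \<in> Hom C x a" "u' \<in> Hom C x a"
    and "m \<cdot>\<^bsub>C\<^esub> u = m \<cdot>\<^bsub>C\<^esub> u'"
  shows "u = u'"
  using assms HomD(2)[OF assms(2)] by (auto simp: is_mono_def)

lemma epi_cancel:
  assumes "is_epi C e" "e \<in> Hom C a b" "u \<in> Hom C b x" "u' \<in> Hom C b x"
    and "u \<cdot>\<^bsub>C\<^esub> e = u' \<cdot>\<^bsub>C\<^esub> e"
  shows "u = u'"
  using assms HomD(3)[OF assms(2)] by (auto simp: is_epi_def)

section \<open>Composites of monomorphisms and of epimorphisms\<close>

context category
begin

lemma Hom_Obj:
  assumes "f \<in> Hom C a b"
  shows "a \<in> Obj C" "b \<in> Obj C"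
  using assms dom_in_Obj cod_in_Obj by (auto simp: Hom_def)

lemma is_epi_comp:
  assumes e: "is_epi C e" "e \<in> Hom C a b" and e': "is_epi C e'" "e' \<in> Hom C b c"
  shows "is_epi C (e' \<cdot> e)"
  unfolding is_epi_def
proof (intro conjI allI ballI impI)
  have ee: "e' \<cdot> e \<in> Hom C a c" using e e' comp_in_Hom by blast
  show "e' \<cdot> e \<in> Arr C" using HomD[OF ee] by simp
  fix x u u'
  assume "u \<in> Hom C (Cod C (e' \<cdot> e)) x" "u' \<in> Hom C (Cod C (e' \<cdot> e)) x"
    and eq: "u \<cdot> (e' \<cdot> e) = u' \<cdot> (e' \<cdot> e)"
  then have u: "u \<in> Hom C c x" "u' \<in> Hom C c x" using HomD[OF ee] by auto
  have "(u \<cdot> e') \<cdot> e = (u' \<cdot> e') \<cdot> e"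
    using eq comp_assoc[OF e(2) e'(2)] u by simp
  then have "u \<cdot> e' = u' \<cdot> e'"
    using epi_cancel[OF e] comp_in_Hom[OF e'(2)] u by blast
  then show "u = u'" using epi_cancel[OF e'] u by blast
qed

lemma is_mono_comp:
  assumes m: "is_mono C m" "m \<in> Hom C a b" and m': "is_mono C m'" "m' \<in> Hom C b c"
  shows "is_mono C (m' \<cdot> m)"
  unfolding is_mono_def
proof (intro conjI allI ballI impI)
  have mm: "m' \<cdot> m \<in> Hom C a c" using m m' comp_in_Hom by blast
  show "m' \<cdot> m \<in> Arr C" using HomD[OF mm] by simp
  fix x u u'
  assume "u \<in> Hom C x (Dom C (m' \<cdot> m))" "u' \<in> Hom C x (Dom C (m' \<cdot> m))"
    and eq: "(m' \<cdot> m) \<cdot> u = (m' \<cdot> m) \<cdot> u'"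
  then have u: "u \<in> Hom C x a" "u' \<in> Hom C x a" using HomD[OF mm] by auto
  have "m' \<cdot> (m \<cdot> u) = m' \<cdot> (m \<cdot> u')"
    using eq comp_assoc[OF _ m(2) m'(2)] u by simp
  then have "m \<cdot> u = m \<cdot> u'"
    using mono_cancel[OF m'] comp_in_Hom[OF _ m(2)] u by blast
  then show "u = u'" using mono_cancel[OF m] u by blast
qed

lemma ident_epi: "a \<in> Obj C \<Longrightarrow> is_epi C (Ident C a)"
  using ident_in_Hom[of a] by (auto simp: is_epi_def Hom_def comp_ident_right)

end

section \<open>Arithmetic of zero morphisms; cancellation in additive form\<close>

context preadditive_category
begin

lemma zero_in_Hom: "a \<in> Obj C \<Longrightarrow> b \<in> Obj C \<Longrightarrow> Zero C a b \<in> Hom C a b"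
  using monoid.one_closed[OF comm_group.axioms(1)[THEN comm_monoid.axioms(1), OF hom_comm_group]]
  by (simp add: hom_group_def)

lemma add_in_Hom:
  assumes "f \<in> Hom C a b" "g \<in> Hom C a b"
  shows "f \<oplus> g \<in> Hom C a b"
proof -
  interpret comm_group "hom_group C a b" using Hom_Obj[OF assms(1)] by (rule hom_comm_group)
  show ?thesis using m_closed[of f g] assms by (simp add: hom_group_def)
qed

lemma add_zero:
  assumes "f \<in> Hom C a b"
  shows "f \<oplus> Zero C a b = f" "Zero C a b \<oplus> f = f"
proof -
  interpret comm_group "hom_group C a b" using Hom_Obj[OF assms] by (rule hom_comm_group)
  show "f \<oplus> Zero C a b = f" "Zero C a b \<oplus> f = f"
    using r_one[of f] l_one[of f] assms by (simp_all add: hom_group_def)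
qed

lemma add_right_cancel:
  assumes "f \<in> Hom C a b" "g \<in> Hom C a b" "h \<in> Hom C a b" "f \<oplus> h = g \<oplus> h"
  shows "f = g"
proof -
  interpret comm_group "hom_group C a b" using Hom_Obj[OF assms(1)] by (rule hom_comm_group)
  show ?thesis using right_cancel[of h f g] assms by (simp add: hom_group_def)
qed

lemma add_inverse:
  assumes "f \<in> Hom C a b"
  obtains f' where "f' \<in> Hom C a b" "f \<oplus> f' = Zero C a b"
proof -
  interpret comm_group "hom_group C a b" using Hom_Obj[OF assms] by (rule hom_comm_group)
  show ?thesis using that r_inv[of f] inv_closed[of f] assms by (simp add: hom_group_def)
qed

lemma comp_zero_right:
  assumes "g \<in> Hom C b c" "a \<in> Obj C"
  shows "g \<cdot> Zero C a b = Zero C a c"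
proof -
  have z: "Zero C a b \<in> Hom C a b" "Zero C a c \<in> Hom C a c"
    using zero_in_Hom Hom_Obj assms by blast+
  \<comment> \<open>By distributivity \<open>g \<cdot> 0\<close> equals its own double; cancelling
    one copy in the hom group leaves zero.\<close>
  have "g \<cdot> Zero C a b \<oplus> g \<cdot> Zero C a b = Zero C a c \<oplus> g \<cdot> Zero C a b"
    using comp_add_right[OF z(1) z(1) assms(1)] add_zero[OF z(1)]
      add_zero[OF comp_in_Hom[OF z(1) assms(1)]] by simp
  then show ?thesis using add_right_cancel z comp_in_Hom[OF z(1) assms(1)] by blast
qed

lemma comp_zero_left:
  assumes "f \<in> Hom C a b" "c \<in> Obj C"
  shows "Zero C b c \<cdot> f = Zero C a c"
proof -
  have z: "Zero C b c \<in> Hom C b c" "Zero C a c \<in> Hom C a c"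
    using zero_in_Hom Hom_Obj assms by blast+
  have "Zero C b c \<cdot> f \<oplus> Zero C b c \<cdot> f = Zero C a c \<oplus> Zero C b c \<cdot> f"
    using comp_add_left[OF assms(1) z(1) z(1)] add_zero[OF z(1)]
      add_zero[OF comp_in_Hom[OF assms(1) z(1)]] by simp
  then show ?thesis using add_right_cancel z comp_in_Hom[OF assms(1) z(1)] by blast
qed

text \<open>Since composition is additive, cancelling \<open>e\<close> from
  \<open>u \<cdot> e = u' \<cdot> e\<close> amounts to testing the difference of \<open>u\<close>
  and \<open>u'\<close>, formed below as \<open>u \<oplus> n\<close> with \<open>n\<close> the
  inverse of \<open>u'\<close>.\<close>

lemma is_epiI:
  assumes e: "e \<in> Hom C a b"
    and cancel: "\<And>x u. u \<in> Hom C b x \<Longrightarrow> u \<cdot> e = Zero C a x \<Longrightarrow> u = Zero C b x"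
  shows "is_epi C e"
  unfolding is_epi_def
proof (intro conjI allI ballI impI)
  show "e \<in> Arr C" using HomD[OF e] by simp
  fix x u u'
  assume "u \<in> Hom C (Cod C e) x" "u' \<in> Hom C (Cod C e) x" and eq: "u \<cdot> e = u' \<cdot> e"
  then have u: "u \<in> Hom C b x" "u' \<in> Hom C b x" using HomD[OF e] by auto
  obtain n where n: "n \<in> Hom C b x" "u' \<oplus> n = Zero C b x" using add_inverse[OF u(2)] .
  have "(u \<oplus> n) \<cdot> e = (u' \<oplus> n) \<cdot> e" using comp_add_left[OF e] u n(1) eq by simp
  also have "\<dots> = Zero C a x" using n(2) comp_zero_left[OF e] Hom_Obj[OF u(1)] by simp
  finally have "u \<oplus> n = u' \<oplus> n" using cancel[OF add_in_Hom[OF u(1) n(1)]] n(2) by simp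
  then show "u = u'" using add_right_cancel u n by blast
qed

text \<open>The composite \<open>k \<cdot> u\<close> is killed by \<open>f\<close>, so uniqueness of
  its factorization through \<open>k\<close> gives the cancellation. The proof of
  \<open>cokernel_epi\<close> is dual.\<close>

lemma kernel_mono:
  assumes "is_kernel C f k"
  shows "is_mono C k"
  unfolding is_mono_def
proof (intro conjI allI ballI impI)
  have f: "f \<in> Hom C (Dom C f) (Cod C f)" using assms by (auto simp: is_kernel_def Hom_def)
  note k = kernel_in_Hom[OF assms f]
  show "k \<in> Arr C" using HomD[OF k] by simp
  fix x u u'
  assume u: "u \<in> Hom C x (Dom C k)" "u' \<in> Hom C x (Dom C k)" and eq: "k \<cdot> u = k \<cdot> u'"
  have "f \<cdot> (k \<cdot> u) = Zero C x (Cod C f)"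
    using comp_assoc[OF u(1) k f] kernel_comp[OF assms f] comp_zero_left[OF u(1)] Hom_Obj[OF f]
    by simp
  then have "\<exists>!v. v \<in> Hom C x (Dom C k) \<and> k \<cdot> v = k \<cdot> u"
    using assms comp_in_Hom[OF u(1) k] by (auto simp: is_kernel_def)
  then show "u = u'" using u eq by metis
qed

lemma cokernel_epi:
  assumes "is_cokernel C f q"
  shows "is_epi C q"
  unfolding is_epi_def
proof (intro conjI allI ballI impI)
  have f: "f \<in> Hom C (Dom C f) (Cod C f)" using assms by (auto simp: is_cokernel_def Hom_def)
  note q = cokernel_in_Hom[OF assms f]
  show "q \<in> Arr C" using HomD[OF q] by simp
  fix x u u'
  assume u: "u \<in> Hom C (Cod C q) x" "u' \<in> Hom C (Cod C q) x" and eq: "u \<cdot> q = u' \<cdot> q"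
  have "(u \<cdot> q) \<cdot> f = Zero C (Dom C f) x"
    using comp_assoc[OF f q u(1)] cokernel_comp[OF assms f] comp_zero_right[OF u(1)] Hom_Obj[OF f]
    by simp
  then have "\<exists>!v. v \<in> Hom C (Cod C q) x \<and> v \<cdot> q = u \<cdot> q"
    using assms comp_in_Hom[OF q u(1)] by (auto simp: is_cokernel_def)
  then show "u = u'" using u eq by metis
qed

end

section \<open>Epimorphic covers, images, and the lifting criterion for exactness\<close>

context abelian_category
begin

text \<open>Some \<open>r\<close> has \<open>e\<close> as its cokernel. Since
  \<open>e \<cdot> r = 0\<close>, this \<open>r\<close> factors through \<open>k\<close>, so
  whatever kills \<open>k\<close> also kills \<open>r\<close> and hence factors through
  \<open>e\<close>.\<close>

lemma epi_cokernel_of_kernel: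
  assumes e: "is_epi C e" "e \<in> Hom C a b" and k: "is_kernel C e k"
    and h: "h \<in> Hom C a x" "h \<cdot> k = Zero C (Dom C k) x"
  obtains u where "u \<in> Hom C b x" "u \<cdot> e = h"
proof -
  obtain r where r: "is_cokernel C r e" using epi_is_cokernel[OF e(1)] by blast
  have r': "r \<in> Hom C (Dom C r) a" using r HomD[OF e(2)] by (auto simp: is_cokernel_def Hom_def)
  have kH: "k \<in> Hom C (Dom C k) a" by (rule kernel_in_Hom[OF k e(2)])
  have "e \<cdot> r = Zero C (Dom C r) b" using cokernel_comp[OF r r'] HomD[OF e(2)] by simp
  then obtain s where s: "s \<in> Hom C (Dom C r) (Dom C k)" "k \<cdot> s = r"
    using kernel_lift[OF k e(2) r'] by blast
  have "h \<cdot> r = Zero C (Dom C r) x"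
    using comp_assoc[OF s(1) kH h(1)] s(2) h(2) comp_zero_left[OF s(1)] Hom_Obj[OF h(1)] by simp
  then obtain u where "u \<in> Hom C (Cod C e) x" "u \<cdot> e = h" using cokernel_lift[OF r r' h(1)] by blast
  then show ?thesis using that HomD[OF e(2)] by simp
qed

text \<open>The cover \<open>e'\<close> is the pullback of \<open>e\<close> along \<open>h\<close>, constructed as the kernel of
  \<open>e \<cdot> p - h \<cdot> q\<close> on the biproduct of the two domains.\<close>

lemma epi_lift:
  assumes e: "is_epi C e" "e \<in> Hom C a b" and h: "h \<in> Hom C x b"
  obtains y e' t where "is_epi C e'" "e' \<in> Hom C y x" "t \<in> Hom C y a" "e \<cdot> t = h \<cdot> e'"
proof -
  obtain s i j p q where "is_biproduct C a x s i j p q"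
    using biproduct_exists[OF Hom_Obj(1)[OF e(2)] Hom_Obj(1)[OF h]] by blast
  then have i: "i \<in> Hom C a s" and j: "j \<in> Hom C x s" and p: "p \<in> Hom C s a" and q: "q \<in> Hom C s x"
    and pi: "p \<cdot> i = Ident C a" and qj: "q \<cdot> j = Ident C x" and qi: "q \<cdot> i = Zero C a x"
    by (auto simp: is_biproduct_def)
  note objs = Hom_Obj[OF e(2)] Hom_Obj[OF h] Hom_Obj[OF i]
  \<comment> \<open>Here \<open>n\<close> is the additive inverse of \<open>h\<close>, so
    \<open>d\<close> below is the difference of \<open>e \<cdot> p\<close> and
    \<open>h \<cdot> q\<close>.\<close>
  obtain n where n: "n \<in> Hom C x b" "h \<oplus> n = Zero C x b" using add_inverse[OF h] .
  define d where "d = e \<cdot> p \<oplus> n \<cdot> q"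
  have ep: "e \<cdot> p \<in> Hom C s b" and nq: "n \<cdot> q \<in> Hom C s b" using comp_in_Hom e p n q by blast+
  have d: "d \<in> Hom C s b" unfolding d_def by (rule add_in_Hom[OF ep nq])
  have di: "d \<cdot> i = e"
    unfolding d_def
    using comp_add_left[OF i ep nq] comp_assoc[OF i p e(2)] comp_assoc[OF i q n(1)] pi qi
      comp_ident_right[OF e(2)] comp_zero_right[OF n(1)] add_zero[OF e(2)] objs by simp
  \<comment> \<open>A morphism killing \<open>d\<close> also kills \<open>d \<cdot> i = e\<close>,
    which is epi.\<close>
  have epi_d: "is_epi C d"
  proof (rule is_epiI[OF d])
    fix w u assume u: "u \<in> Hom C b w" "u \<cdot> d = Zero C s w"
    have "u \<cdot> e = Zero C b w \<cdot> e"
      using comp_assoc[OF i d u(1)] di u(2) comp_zero_left[OF i] comp_zero_left[OF e(2)]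
        Hom_Obj[OF u(1)] by simp
    then show "u = Zero C b w" using epi_cancel[OF e u(1)] zero_in_Hom Hom_Obj[OF u(1)] by blast
  qed
  obtain l where l: "is_kernel C d l" using kernel_exists HomD(1)[OF d] by blast
  define y where "y = Dom C l"
  have lH: "l \<in> Hom C y s" unfolding y_def by (rule kernel_in_Hom[OF l d])
  have pl: "p \<cdot> l \<in> Hom C y a" and ql: "q \<cdot> l \<in> Hom C y x" using comp_in_Hom lH p q by blast+
  have "e \<cdot> (p \<cdot> l) \<oplus> n \<cdot> (q \<cdot> l) = d \<cdot> l"
    unfolding d_def
    using comp_add_left[OF lH ep nq] comp_assoc[OF lH p e(2)] comp_assoc[OF lH q n(1)] by simp
  also have "\<dots> = Zero C y b" unfolding y_def by (rule kernel_comp[OF l d])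
  \<comment> \<open>Rewriting zero as \<open>(h \<oplus> n) \<cdot> (q \<cdot> l)\<close> creates
    the common summand \<open>n \<cdot> (q \<cdot> l)\<close>; cancelling it makes the pullback
    square commute.\<close>
  also have "\<dots> = h \<cdot> (q \<cdot> l) \<oplus> n \<cdot> (q \<cdot> l)"
    using comp_add_left[OF ql h n(1)] n(2) comp_zero_left[OF ql] objs by simp
  finally have eq: "e \<cdot> (p \<cdot> l) = h \<cdot> (q \<cdot> l)"
    using add_right_cancel comp_in_Hom[OF pl e(2)] comp_in_Hom[OF ql h] comp_in_Hom[OF ql n(1)]
    by blast
  \<comment> \<open>If \<open>u\<close> kills \<open>q \<cdot> l\<close>, then
    \<open>u \<cdot> q\<close> kills the kernel of the epimorphism \<open>d\<close>, hence is
    \<open>v \<cdot> d\<close>. Restricting along \<open>i\<close> gives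
    \<open>v \<cdot> e = 0\<close>, so \<open>v = 0\<close> and \<open>u \<cdot> q = 0\<close>;
    restricting along \<open>j\<close> gives \<open>u = 0\<close>.\<close>
  have "is_epi C (q \<cdot> l)"
  proof (rule is_epiI[OF ql])
    fix w u assume u: "u \<in> Hom C x w" "u \<cdot> (q \<cdot> l) = Zero C y w"
    note w = Hom_Obj(2)[OF u(1)]
    have uq: "u \<cdot> q \<in> Hom C s w" by (rule comp_in_Hom[OF q u(1)])
    have "(u \<cdot> q) \<cdot> l = Zero C (Dom C l) w"
      using comp_assoc[OF lH q u(1)] u(2) y_def by simp
    then obtain v where v: "v \<in> Hom C b w" "v \<cdot> d = u \<cdot> q"
      using epi_cokernel_of_kernel[OF epi_d d l uq] by blast
    have "v \<cdot> e = (u \<cdot> q) \<cdot> i" using comp_assoc[OF i d v(1)] di v(2) by simp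
    also have "\<dots> = Zero C b w \<cdot> e"
      using comp_assoc[OF i q u(1)] qi comp_zero_right[OF u(1)] comp_zero_left[OF e(2)] objs w
      by simp
    finally have "v = Zero C b w" using epi_cancel[OF e v(1)] zero_in_Hom objs w by blast
    then have "u \<cdot> q = Zero C s w" using v(2) comp_zero_left[OF d w] by simp
    then show "u = Zero C x w"
      using comp_assoc[OF j q u(1)] qj comp_ident_right[OF u(1)] comp_zero_left[OF j w] by simp
  qed
  then show ?thesis using that ql pl eq by blast
qed

text \<open>The image is the least subobject through which \<open>f\<close> factors. If
  \<open>u\<close> kills \<open>e\<close>, then \<open>f\<close> factors through the smaller
  subobject \<open>m \<cdot> n\<close>, where \<open>n\<close> is the kernel of \<open>u\<close>.
  This mono is a kernel of some \<open>r\<close>; as \<open>r\<close> kills \<open>f\<close>, it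
  factors through \<open>q\<close> and so kills \<open>m\<close>. Thus \<open>m\<close> factors
  through \<open>m \<cdot> n\<close>, which gives \<open>n\<close> a right inverse \<open>v\<close>
  and forces \<open>u = 0\<close>.\<close>

lemma epi_onto_image:
  assumes f: "f \<in> Hom C a b" and q: "is_cokernel C f q" and m: "is_kernel C q m"
    and e: "e \<in> Hom C a (Dom C m)" "m \<cdot> e = f"
  shows "is_epi C e"
proof (rule is_epiI[OF e(1)])
  fix w u assume u: "u \<in> Hom C (Dom C m) w" "u \<cdot> e = Zero C a w"
  note qH = cokernel_in_Hom[OF q f] and w = Hom_Obj(2)[OF u(1)]
  have mH: "m \<in> Hom C (Dom C m) b" by (rule kernel_in_Hom[OF m qH])
  obtain n where n: "is_kernel C u n" using kernel_exists HomD(1)[OF u(1)] by blast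
  have nH: "n \<in> Hom C (Dom C n) (Dom C m)" by (rule kernel_in_Hom[OF n u(1)])
  have mn: "m \<cdot> n \<in> Hom C (Dom C n) b" by (rule comp_in_Hom[OF nH mH])
  obtain e' where e': "e' \<in> Hom C a (Dom C n)" "n \<cdot> e' = e" using kernel_lift[OF n u(1) e(1) u(2)] .
  obtain r where r: "is_kernel C r (m \<cdot> n)"
    using mono_is_kernel is_mono_comp[OF kernel_mono[OF n] nH kernel_mono[OF m] mH] by blast
  define c where "c = Cod C r"
  have rH: "r \<in> Hom C b c" using r HomD[OF mn] by (auto simp: is_kernel_def Hom_def c_def)
  have rmn: "r \<cdot> (m \<cdot> n) = Zero C (Dom C n) c" using kernel_comp[OF r rH] HomD[OF mn] by simp
  have "r \<cdot> f = (r \<cdot> (m \<cdot> n)) \<cdot> e'"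
    using comp_assoc[OF e'(1) nH mH] comp_assoc[OF e'(1) mn rH] e' e by simp
  then have "r \<cdot> f = Zero C a c" using rmn comp_zero_left[OF e'(1)] Hom_Obj[OF rH] by simp
  then obtain r' where r': "r' \<in> Hom C (Cod C q) c" "r' \<cdot> q = r" using cokernel_lift[OF q f rH] by blast
  have "r \<cdot> m = Zero C (Dom C m) c"
    using comp_assoc[OF mH qH r'(1)] r'(2) kernel_comp[OF m qH] comp_zero_right[OF r'(1)]
      Hom_Obj[OF mH] by simp
  then obtain v where "v \<in> Hom C (Dom C m) (Dom C (m \<cdot> n))" and v2: "(m \<cdot> n) \<cdot> v = m"
    using kernel_lift[OF r rH mH] by blast
  then have v: "v \<in> Hom C (Dom C m) (Dom C n)" using HomD[OF mn] by simp
  have I: "Ident C (Dom C m) \<in> Hom C (Dom C m) (Dom C m)" using ident_in_Hom Hom_Obj[OF mH] by blast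
  have "m \<cdot> (n \<cdot> v) = m \<cdot> Ident C (Dom C m)"
    using comp_assoc[OF v nH mH] v2 comp_ident_right[OF mH] by simp
  then have nv: "n \<cdot> v = Ident C (Dom C m)"
    using mono_cancel[OF kernel_mono[OF m] mH] comp_in_Hom[OF v nH] I by blast
  have "u = (u \<cdot> n) \<cdot> v" using comp_assoc[OF v nH u(1)] nv comp_ident_right[OF u(1)] by simp
  then show "u = Zero C (Dom C m) w"
    using kernel_comp[OF n u(1)] comp_zero_left[OF v w] by simp
qed

text \<open>The morphism \<open>h\<close> factors through the image \<open>m\<close> of
  \<open>f\<close>. Since \<open>f\<close> maps epimorphically onto that image, the factor
  \<open>k\<close> lifts after passing to a cover.\<close>

lemma cokernel_zero_lift:
  assumes f: "f \<in> Hom C a b" and q: "is_cokernel C f q"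
    and h: "h \<in> Hom C x b" "q \<cdot> h = Zero C x (Cod C q)"
  obtains y e t where "is_epi C e" "e \<in> Hom C y x" "t \<in> Hom C y a" "f \<cdot> t = h \<cdot> e"
proof -
  note qH = cokernel_in_Hom[OF q f]
  obtain m where m: "is_kernel C q m" using kernel_exists HomD(1)[OF qH] by blast
  have mH: "m \<in> Hom C (Dom C m) b" by (rule kernel_in_Hom[OF m qH])
  obtain e where e: "e \<in> Hom C a (Dom C m)" "m \<cdot> e = f"
    using kernel_lift[OF m qH f cokernel_comp[OF q f]] .
  obtain k where k: "k \<in> Hom C x (Dom C m)" "m \<cdot> k = h" using kernel_lift[OF m qH h] .
  obtain y e' t where t: "is_epi C e'" "e' \<in> Hom C y x" "t \<in> Hom C y a" "e \<cdot> t = k \<cdot> e'"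
    using epi_lift[OF epi_onto_image[OF f q m e] e(1) k(1)] .
  have "f \<cdot> t = h \<cdot> e'"
    using comp_assoc[OF t(3) e(1) mH] comp_assoc[OF t(2) k(1) mH] t(4) e(2) k(2) by simp
  then show ?thesis using that t by blast
qed

text \<open>The image \<open>i\<close> of \<open>f\<close> is shown to be a kernel of
  \<open>g\<close>. If \<open>g\<close> kills \<open>h\<close>, then on the cover
  \<open>q \<cdot> h\<close> becomes \<open>q \<cdot> f \<cdot> t = 0\<close>. Cancelling the cover
  gives \<open>q \<cdot> h = 0\<close>, so \<open>h\<close> already factors through \<open>i\<close>
  without any cover.\<close>

lemma exact_atI:
  assumes f: "f \<in> Hom C a b" and g: "g \<in> Hom C b c" and gf: "g \<cdot> f = Zero C a c"
    and lift: "\<And>x h. h \<in> Hom C x b \<Longrightarrow> g \<cdot> h = Zero C x c \<Longrightarrow>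
      \<exists>y e t. is_epi C e \<and> e \<in> Hom C y x \<and> t \<in> Hom C y a \<and> f \<cdot> t = h \<cdot> e"
  shows "exact_at C f g"
proof -
  obtain q where q: "is_cokernel C f q" using cokernel_exists HomD(1)[OF f] by blast
  note qH = cokernel_in_Hom[OF q f]
  obtain i where i: "is_kernel C q i" using kernel_exists HomD(1)[OF qH] by blast
  have iH: "i \<in> Hom C (Dom C i) b" by (rule kernel_in_Hom[OF i qH])
  obtain g' where g': "g' \<in> Hom C (Cod C q) c" "g' \<cdot> q = g" using cokernel_lift[OF q f g gf] .
  have gi: "g \<cdot> i = Zero C (Dom C i) c"
    using comp_assoc[OF iH qH g'(1)] g'(2) kernel_comp[OF i qH] comp_zero_right[OF g'(1)]
      Hom_Obj[OF iH] by simp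
  have "\<exists>!u. u \<in> Hom C x (Dom C i) \<and> i \<cdot> u = h"
    if h: "h \<in> Hom C x b" "g \<cdot> h = Zero C x c" for x h
  proof -
    obtain y e t where e: "is_epi C e" "e \<in> Hom C y x" and t: "t \<in> Hom C y a" "f \<cdot> t = h \<cdot> e"
      using lift[OF h] by blast
    note x = Hom_Obj[OF h(1)] and o = Hom_Obj[OF qH]
    have "(q \<cdot> h) \<cdot> e = (q \<cdot> f) \<cdot> t"
      using comp_assoc[OF e(2) h(1) qH] comp_assoc[OF t(1) f qH] t(2) by simp
    also have "\<dots> = Zero C x (Cod C q) \<cdot> e"
      using cokernel_comp[OF q f] comp_zero_left[OF t(1)] comp_zero_left[OF e(2)] o by simp
    finally have "q \<cdot> h = Zero C x (Cod C q)"
      using epi_cancel[OF e] comp_in_Hom[OF h(1) qH] zero_in_Hom x o by blast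
    then obtain u where u: "u \<in> Hom C x (Dom C i)" "i \<cdot> u = h" using kernel_lift[OF i qH h(1)] by blast
    then show ?thesis using mono_cancel[OF kernel_mono[OF i] iH] by metis
  qed
  then have "is_kernel C g i"
    using gi HomD[OF iH] HomD[OF g] by (auto simp: is_kernel_def)
  then show ?thesis
    using q i HomD[OF f] HomD[OF g] by (auto simp: exact_at_def is_image_def)
qed

text \<open>This serves the left end of the sequence. The hypothesis \<open>inj\<close> forces
  \<open>h\<close> to vanish, so the identity is a sufficient cover and the zero morphism into
  \<open>z\<close> is a lift.\<close>

lemma exact_at_mono:
  assumes u: "u \<in> Hom C a b" and z: "z \<in> Obj C"
    and inj: "\<And>x h. h \<in> Hom C x a \<Longrightarrow> u \<cdot> h = Zero C x b \<Longrightarrow> h = Zero C x a"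
  shows "exact_at C (Zero C z a) u"
proof (rule exact_atI[OF zero_in_Hom[OF z Hom_Obj(1)[OF u]] u comp_zero_right[OF u z]])
  fix x h assume h: "h \<in> Hom C x a" "u \<cdot> h = Zero C x b"
  note x = Hom_Obj[OF h(1)]
  have "Zero C z a \<cdot> Zero C x z = h \<cdot> Ident C x"
    using comp_zero_left[OF zero_in_Hom[OF x(1) z] x(2)] comp_ident_right[OF h(1)] inj[OF h] by simp
  then show "\<exists>y e t. is_epi C e \<and> e \<in> Hom C y x \<and> t \<in> Hom C y z \<and> Zero C z a \<cdot> t = h \<cdot> e"
    using ident_epi ident_in_Hom zero_in_Hom x z by blast
qed

end

section \<open>The kernel-cokernel sequence of a composite\<close>

theorem theorem1:
  fixes C :: "('o, 'm, 'e) preadditive_data_scheme" (structure)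
    and a b c z :: 'o
    and f g kf kgf kg qf qgf qg :: 'm
  assumes "abelian_category C"
    and "f \<in> Hom C a b" and "g \<in> Hom C b c"
    and "is_kernel C f kf" and "is_kernel C (g \<cdot> f) kgf" and "is_kernel C g kg"
    and "is_cokernel C f qf" and "is_cokernel C (g \<cdot> f) qgf" and "is_cokernel C g qg"
    and "is_zero_object C z"
  shows "\<exists>u v w x.
      u \<in> Hom C (Dom C kf) (Dom C kgf) \<and> kgf \<cdot> u = kf \<and>
      v \<in> Hom C (Dom C kgf) (Dom C kg) \<and> kg \<cdot> v = f \<cdot> kgf \<and>
      w \<in> Hom C (Cod C qf) (Cod C qgf) \<and> w \<cdot> qf = qgf \<cdot> g \<and>
      x \<in> Hom C (Cod C qgf) (Cod C qg) \<and> x \<cdot> qgf = qg \<and>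
      exact_sequence C
        [Zero C z (Dom C kf), u, v, qf \<cdot> kg, w, x, Zero C (Cod C qg) z]"
proof -
  interpret abelian_category C by fact
  note f = assms(2) and g = assms(3) and kf = assms(4) and kgf = assms(5) and kg = assms(6)
    and qf = assms(7) and qgf = assms(8) and qg = assms(9)
  have gf: "g \<cdot> f \<in> Hom C a c" by (rule comp_in_Hom[OF f g])
  define Kf where "Kf = Dom C kf"
  define Kgf where "Kgf = Dom C kgf"
  define Kg where "Kg = Dom C kg"
  define Qf where "Qf = Cod C qf"
  define Qgf where "Qgf = Cod C qgf"
  define Qg where "Qg = Cod C qg"
  note defs = Kf_def Kgf_def Kg_def Qf_def Qgf_def Qg_def
  note kfH = kernel_in_Hom[OF kf f, folded defs] and kgfH = kernel_in_Hom[OF kgf gf, folded defs]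
    and kgH = kernel_in_Hom[OF kg g, folded defs]
  note qfH = cokernel_in_Hom[OF qf f, folded defs] and qgfH = cokernel_in_Hom[OF qgf gf, folded defs]
    and qgH = cokernel_in_Hom[OF qg g, folded defs]
  note f_kf = kernel_comp[OF kf f, folded defs] and gf_kgf = kernel_comp[OF kgf gf, folded defs]
    and g_kg = kernel_comp[OF kg g, folded defs]
  note qf_f = cokernel_comp[OF qf f, folded defs] and qgf_gf = cokernel_comp[OF qgf gf, folded defs]
    and qg_g = cokernel_comp[OF qg g, folded defs]
  note objs = Hom_Obj[OF f] Hom_Obj[OF g] Hom_Obj[OF kfH] Hom_Obj[OF kgfH] Hom_Obj[OF kgH]
    Hom_Obj[OF qfH] Hom_Obj[OF qgfH] Hom_Obj[OF qgH]
  have z: "z \<in> Obj C" using assms(10) by (simp add: is_zero_object_def)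

  \<comment> \<open>The four induced morphisms, from the universal properties\<close>
  have "(g \<cdot> f) \<cdot> kf = Zero C Kf c"
    using comp_assoc[OF kfH f g] f_kf comp_zero_right[OF g] objs by simp
  then obtain u where u: "u \<in> Hom C Kf Kgf" "kgf \<cdot> u = kf"
    using kernel_lift[OF kgf gf kfH] unfolding defs by blast
  have fkgf: "f \<cdot> kgf \<in> Hom C Kgf b" by (rule comp_in_Hom[OF kgfH f])
  have "g \<cdot> (f \<cdot> kgf) = Zero C Kgf c" using comp_assoc[OF kgfH f g] gf_kgf by simp
  then obtain v where v: "v \<in> Hom C Kgf Kg" "kg \<cdot> v = f \<cdot> kgf"
    using kernel_lift[OF kg g fkgf] unfolding defs by blast
  have qgfg: "qgf \<cdot> g \<in> Hom C b Qgf" by (rule comp_in_Hom[OF g qgfH])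
  have "(qgf \<cdot> g) \<cdot> f = Zero C a Qgf" using comp_assoc[OF f g qgfH] qgf_gf by simp
  then obtain w where w: "w \<in> Hom C Qf Qgf" "w \<cdot> qf = qgf \<cdot> g"
    using cokernel_lift[OF qf f qgfg] unfolding defs by blast
  have "qg \<cdot> (g \<cdot> f) = Zero C a Qg"
    using comp_assoc[OF f g qgH] qg_g comp_zero_left[OF f] objs by simp
  then obtain x where x: "x \<in> Hom C Qgf Qg" "x \<cdot> qgf = qg"
    using cokernel_lift[OF qgf gf qgH] unfolding defs by blast
  have \<delta>: "qf \<cdot> kg \<in> Hom C Kg Qf" by (rule comp_in_Hom[OF kgH qfH])

  \<comment> \<open>Exactness at the six inner objects\<close>
  have ex1: "exact_at C (Zero C z Kf) u"
  proof (rule exact_at_mono[OF u(1) z])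
    fix y h assume h: "h \<in> Hom C y Kf" "u \<cdot> h = Zero C y Kgf"
    note y = Hom_Obj(1)[OF h(1)]
    \<comment> \<open>The map \<open>u\<close> inherits injectivity from
      \<open>kf = kgf \<cdot> u\<close>.\<close>
    have "kf \<cdot> h = kf \<cdot> Zero C y Kf"
      using comp_assoc[OF h(1) u(1) kgfH] u(2) h(2) comp_zero_right[OF kgfH y] comp_zero_right[OF kfH y]
      by simp
    then show "h = Zero C y Kf"
      using mono_cancel[OF kernel_mono[OF kf] kfH h(1)] zero_in_Hom y objs by blast
  qed

  \<comment> \<open>The composite is tested after the monomorphism \<open>kg\<close>, where it
    becomes \<open>f \<cdot> kf\<close>.\<close>
  have "kg \<cdot> (v \<cdot> u) = kg \<cdot> Zero C Kf Kg"
    using comp_assoc[OF u(1) v(1) kgH] v(2) comp_assoc[OF u(1) kgfH f] u(2) f_kf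
      comp_zero_right[OF kgH] objs by simp
  then have vu: "v \<cdot> u = Zero C Kf Kg"
    using mono_cancel[OF kernel_mono[OF kg] kgH] comp_in_Hom[OF u(1) v(1)] zero_in_Hom objs by blast
  have ex2: "exact_at C u v"
  proof (rule exact_atI[OF u(1) v(1) vu])
    fix y h assume h: "h \<in> Hom C y Kgf" "v \<cdot> h = Zero C y Kg"
    note y = Hom_Obj(1)[OF h(1)]
    have kh: "kgf \<cdot> h \<in> Hom C y a" by (rule comp_in_Hom[OF h(1) kgfH])
    \<comment> \<open>An element of the kernel of \<open>g \<cdot> f\<close> killed by
      \<open>v\<close> is killed by \<open>f\<close>, so it lies in the kernel of \<open>f\<close>.
      The lift exists outright, and the identity is the cover.\<close>
    have "f \<cdot> (kgf \<cdot> h) = kg \<cdot> (v \<cdot> h)"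
      using comp_assoc[OF h(1) kgfH f] comp_assoc[OF h(1) v(1) kgH] v(2) by simp
    also have "\<dots> = Zero C y b" using h(2) comp_zero_right[OF kgH y] by simp
    finally obtain t where t: "t \<in> Hom C y Kf" "kf \<cdot> t = kgf \<cdot> h"
      using kernel_lift[OF kf f kh] unfolding defs by blast
    have "kgf \<cdot> (u \<cdot> t) = kgf \<cdot> h" using comp_assoc[OF t(1) u(1) kgfH] u(2) t(2) by simp
    then have "u \<cdot> t = h"
      using mono_cancel[OF kernel_mono[OF kgf] kgfH] comp_in_Hom[OF t(1) u(1)] h(1) by blast
    then show "\<exists>y' e t. is_epi C e \<and> e \<in> Hom C y' y \<and> t \<in> Hom C y' Kf \<and> u \<cdot> t = h \<cdot> e"
      using ident_epi[OF y] ident_in_Hom[OF y] comp_ident_right[OF h(1)] t(1) by metis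
  qed

  have \<delta>v: "(qf \<cdot> kg) \<cdot> v = Zero C Kgf Qf"
    using comp_assoc[OF v(1) kgH qfH] v(2) comp_assoc[OF kgfH f qfH] qf_f comp_zero_left[OF kgfH]
      objs by simp
  have ex3: "exact_at C v (qf \<cdot> kg)"
  proof (rule exact_atI[OF v(1) \<delta> \<delta>v])
    fix y h assume h: "h \<in> Hom C y Kg" "(qf \<cdot> kg) \<cdot> h = Zero C y Qf"
    have kh: "kg \<cdot> h \<in> Hom C y b" by (rule comp_in_Hom[OF h(1) kgH])
    \<comment> \<open>An element of the kernel of \<open>g\<close> that vanishes in the cokernel of
      \<open>f\<close> is locally \<open>f \<cdot> t\<close>. Then \<open>g \<cdot> f\<close> kills
      \<open>t\<close>, so \<open>t\<close> comes from \<open>kgf\<close>, and this preimage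
      \<open>s\<close> is the required lift.\<close>
    have "qf \<cdot> (kg \<cdot> h) = Zero C y Qf" using comp_assoc[OF h(1) kgH qfH] h(2) by simp
    then obtain y' e t where e: "is_epi C e" "e \<in> Hom C y' y"
      and t: "t \<in> Hom C y' a" "f \<cdot> t = (kg \<cdot> h) \<cdot> e"
      using cokernel_zero_lift[OF f qf kh] unfolding defs by blast
    have he: "h \<cdot> e \<in> Hom C y' Kg" by (rule comp_in_Hom[OF e(2) h(1)])
    have ft: "f \<cdot> t = kg \<cdot> (h \<cdot> e)" using t(2) comp_assoc[OF e(2) h(1) kgH] by simp
    have "(g \<cdot> f) \<cdot> t = (g \<cdot> kg) \<cdot> (h \<cdot> e)"
      using comp_assoc[OF t(1) f g] comp_assoc[OF he kgH g] ft by simp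
    also have "\<dots> = Zero C y' c" using g_kg comp_zero_left[OF he] objs by simp
    finally obtain s where s: "s \<in> Hom C y' Kgf" "kgf \<cdot> s = t"
      using kernel_lift[OF kgf gf t(1)] unfolding defs by blast
    have "kg \<cdot> (v \<cdot> s) = kg \<cdot> (h \<cdot> e)"
      using comp_assoc[OF s(1) v(1) kgH] v(2) comp_assoc[OF s(1) kgfH f] s(2) ft by simp
    then have "v \<cdot> s = h \<cdot> e"
      using mono_cancel[OF kernel_mono[OF kg] kgH] comp_in_Hom[OF s(1) v(1)] he by blast
    then show "\<exists>y' e t. is_epi C e \<and> e \<in> Hom C y' y \<and> t \<in> Hom C y' Kgf \<and> v \<cdot> t = h \<cdot> e"
      using e s(1) by blast
  qed

  have w\<delta>: "w \<cdot> (qf \<cdot> kg) = Zero C Kg Qgf"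
    using comp_assoc[OF kgH qfH w(1)] w(2) comp_assoc[OF kgH g qgfH] g_kg comp_zero_right[OF qgfH]
      objs by simp
  have ex4: "exact_at C (qf \<cdot> kg) w"
  proof (rule exact_atI[OF \<delta> w(1) w\<delta>])
    fix y h assume h: "h \<in> Hom C y Qf" "w \<cdot> h = Zero C y Qgf"
    \<comment> \<open>Lift \<open>h\<close> to \<open>t\<close> in \<open>b\<close>. Since
      \<open>g \<cdot> t\<close> vanishes in the cokernel of \<open>g \<cdot> f\<close>, it is
      \<open>(g \<cdot> f) \<cdot> s\<close> on a second cover. Correcting \<open>t\<close> by
      \<open>f \<cdot> s\<close> moves it into the kernel of \<open>g\<close> without changing its
      class in the cokernel of \<open>f\<close>.\<close>
    obtain y1 e1 t where e1: "is_epi C e1" "e1 \<in> Hom C y1 y"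
      and t: "t \<in> Hom C y1 b" "qf \<cdot> t = h \<cdot> e1"
      using epi_lift[OF cokernel_epi[OF qf] qfH h(1)] .
    have gt: "g \<cdot> t \<in> Hom C y1 c" by (rule comp_in_Hom[OF t(1) g])
    have "qgf \<cdot> (g \<cdot> t) = (w \<cdot> h) \<cdot> e1"
      using comp_assoc[OF t(1) g qgfH] w(2) comp_assoc[OF t(1) qfH w(1)] t(2)
        comp_assoc[OF e1(2) h(1) w(1)] by simp
    also have "\<dots> = Zero C y1 Qgf" using h(2) comp_zero_left[OF e1(2)] objs by simp
    finally obtain y2 e2 s where e2: "is_epi C e2" "e2 \<in> Hom C y2 y1"
      and s: "s \<in> Hom C y2 a" "(g \<cdot> f) \<cdot> s = (g \<cdot> t) \<cdot> e2"
      using cokernel_zero_lift[OF gf qgf gt] unfolding defs by blast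
    note y2 = Hom_Obj(1)[OF s(1)]
    \<comment> \<open>With \<open>n\<close> the inverse of \<open>s\<close>, the morphism
      \<open>d\<close> below is the difference of \<open>t \<cdot> e2\<close> and
      \<open>f \<cdot> s\<close>.\<close>
    obtain n where n: "n \<in> Hom C y2 a" "s \<oplus> n = Zero C y2 a" using add_inverse[OF s(1)] .
    have te: "t \<cdot> e2 \<in> Hom C y2 b" by (rule comp_in_Hom[OF e2(2) t(1)])
    have fs: "f \<cdot> s \<in> Hom C y2 b" and fn: "f \<cdot> n \<in> Hom C y2 b" using comp_in_Hom f s(1) n(1) by blast+
    define d where "d = t \<cdot> e2 \<oplus> f \<cdot> n"
    have d: "d \<in> Hom C y2 b" unfolding d_def by (rule add_in_Hom[OF te fn])
    have "g \<cdot> d = g \<cdot> (f \<cdot> s) \<oplus> g \<cdot> (f \<cdot> n)"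
      unfolding d_def
      using comp_add_right[OF te fn g] comp_assoc[OF e2(2) t(1) g] comp_assoc[OF s(1) f g] s(2) by simp
    also have "\<dots> = g \<cdot> (f \<cdot> (s \<oplus> n))"
      using comp_add_right[OF fs fn g] comp_add_right[OF s(1) n(1) f] by simp
    also have "\<dots> = Zero C y2 c"
      using n(2) comp_zero_right[OF f y2] comp_zero_right[OF g y2] by simp
    finally obtain r where r: "r \<in> Hom C y2 Kg" "kg \<cdot> r = d"
      using kernel_lift[OF kg g d] unfolding defs by blast
    have "qf \<cdot> (f \<cdot> n) = Zero C y2 Qf"
      using comp_assoc[OF n(1) f qfH] qf_f comp_zero_left[OF n(1)] objs by simp
    then have "(qf \<cdot> kg) \<cdot> r = qf \<cdot> (t \<cdot> e2)"
      using comp_assoc[OF r(1) kgH qfH] r(2) comp_add_right[OF te fn qfH]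
        add_zero[OF comp_in_Hom[OF te qfH]] by (simp add: d_def)
    also have "\<dots> = h \<cdot> (e1 \<cdot> e2)"
      using comp_assoc[OF e2(2) t(1) qfH] t(2) comp_assoc[OF e2(2) e1(2) h(1)] by simp
    finally show "\<exists>y' e t. is_epi C e \<and> e \<in> Hom C y' y \<and> t \<in> Hom C y' Kg \<and> (qf \<cdot> kg) \<cdot> t = h \<cdot> e"
      using is_epi_comp[OF e2 e1] comp_in_Hom[OF e2(2) e1(2)] r(1) by blast
  qed

  \<comment> \<open>The composite is tested before the epimorphism is cancelled: precomposed with
    \<open>qf\<close> it becomes \<open>qg \<cdot> g\<close>.\<close>
  have "(x \<cdot> w) \<cdot> qf = Zero C Qf Qg \<cdot> qf"
    using comp_assoc[OF qfH w(1) x(1)] w(2) comp_assoc[OF g qgfH x(1)] x(2) qg_g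
      comp_zero_left[OF qfH] objs by simp
  then have xw: "x \<cdot> w = Zero C Qf Qg"
    using epi_cancel[OF cokernel_epi[OF qf] qfH] comp_in_Hom[OF w(1) x(1)] zero_in_Hom objs by blast
  have ex5: "exact_at C w x"
  proof (rule exact_atI[OF w(1) x(1) xw])
    fix y h assume h: "h \<in> Hom C y Qgf" "x \<cdot> h = Zero C y Qg"
    \<comment> \<open>Lift \<open>h\<close> to \<open>t\<close> in \<open>c\<close>. As
      \<open>x\<close> kills \<open>h\<close>, \<open>t\<close> vanishes in the cokernel of
      \<open>g\<close>, so on a further cover it is \<open>g \<cdot> s\<close>; the class
      \<open>qf \<cdot> s\<close> then maps to \<open>h\<close> under \<open>w\<close>.\<close>
    obtain y1 e1 t where e1: "is_epi C e1" "e1 \<in> Hom C y1 y"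
      and t: "t \<in> Hom C y1 c" "qgf \<cdot> t = h \<cdot> e1"
      using epi_lift[OF cokernel_epi[OF qgf] qgfH h(1)] .
    have "qg \<cdot> t = (x \<cdot> h) \<cdot> e1"
      using comp_assoc[OF t(1) qgfH x(1)] x(2) t(2) comp_assoc[OF e1(2) h(1) x(1)] by simp
    also have "\<dots> = Zero C y1 Qg" using h(2) comp_zero_left[OF e1(2)] objs by simp
    finally obtain y2 e2 s where e2: "is_epi C e2" "e2 \<in> Hom C y2 y1"
      and s: "s \<in> Hom C y2 b" "g \<cdot> s = t \<cdot> e2"
      using cokernel_zero_lift[OF g qg t(1)] unfolding defs by blast
    have "w \<cdot> (qf \<cdot> s) = qgf \<cdot> (t \<cdot> e2)"
      using comp_assoc[OF s(1) qfH w(1)] w(2) comp_assoc[OF s(1) g qgfH] s(2) by simp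
    also have "\<dots> = h \<cdot> (e1 \<cdot> e2)"
      using comp_assoc[OF e2(2) t(1) qgfH] t(2) comp_assoc[OF e2(2) e1(2) h(1)] by simp
    finally show "\<exists>y' e t. is_epi C e \<and> e \<in> Hom C y' y \<and> t \<in> Hom C y' Qf \<and> w \<cdot> t = h \<cdot> e"
      using is_epi_comp[OF e2 e1] comp_in_Hom[OF e2(2) e1(2)] comp_in_Hom[OF s(1) qfH] by blast
  qed

  have ex6: "exact_at C x (Zero C Qg z)"
  proof (rule exact_atI[OF x(1) zero_in_Hom[OF _ z] comp_zero_left[OF x(1) z]])
    show "Qg \<in> Obj C" using objs by simp
    fix y h assume h: "h \<in> Hom C y Qg"
    \<comment> \<open>Because \<open>qg = x \<cdot> qgf\<close> is epi, a local lift
      \<open>t\<close> of \<open>h\<close> along \<open>qg\<close> yields the lift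
      \<open>qgf \<cdot> t\<close> along \<open>x\<close>.\<close>
    obtain y1 e1 t where e1: "is_epi C e1" "e1 \<in> Hom C y1 y"
      and t: "t \<in> Hom C y1 c" "qg \<cdot> t = h \<cdot> e1"
      using epi_lift[OF cokernel_epi[OF qg] qgH h] .
    have "x \<cdot> (qgf \<cdot> t) = h \<cdot> e1" using comp_assoc[OF t(1) qgfH x(1)] x(2) t(2) by simp
    then show "\<exists>y' e t. is_epi C e \<and> e \<in> Hom C y' y \<and> t \<in> Hom C y' Qgf \<and> x \<cdot> t = h \<cdot> e"
      using e1 comp_in_Hom[OF t(1) qgfH] by blast
  qed

  have "exact_sequence C [Zero C z Kf, u, v, qf \<cdot> kg, w, x, Zero C Qg z]"
    using ex1 ex2 ex3 ex4 ex5 ex6 HomD(1)[OF u(1)] HomD(1)[OF v(1)] HomD(1)[OF \<delta>] HomD(1)[OF w(1)]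
      HomD(1)[OF x(1)] HomD(1)[OF zero_in_Hom[OF z]] HomD(1)[OF zero_in_Hom[OF _ z]] objs
    by (simp add: exact_sequence_def)
  then show ?thesis
    using u v w x unfolding defs by blast
qed

end
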